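(* For all integers $d\ge 0$ and $n\ge 1$, $$\mathrm{di}_n=\sum_{k\ge 1}(-1)^{k-1}\binom{n-kd+d}{k}\,\mathrm{di}_{n-k}.$$
   Context: For a sequence $\alpha=a_1a_2\ldots a_n$ of nonnegative integers and $d\ge 0$, an index $k\in\{1,\dots,n-1\}$ is a $d$-ascent of $\alpha$ if $a_{k+1}>a_k-d$; $\mathrm{dasc}\,\alpha$ is the number of $d$-ascents of $\alpha$. Write $\alpha_k=a_1\ldots a_k$. The sequence $\alpha$ is a $d$-ascent sequence if $a_1=0$ and $a_{k+1}\le 1+\mathrm{dasc}\,\alpha_k$ for $k\in\{1,\dots,n-1\}$. It is $d$-increasing if $a_{k+1}>a_k-d$ for all $1\le k<n$. $\mathrm{di}_n$ is the number of $d$-ascent sequences of length $n$ that are $d$-increasing (so $\mathrm{di}_0=1$, counting the empty sequence). Conventions: $\mathrm{di}_j=0$ for $j<0$ (so the sum runs over $1\le k\le n$), and a binomial coefficient $\binom{N}{k}$ is the number of $k$-element subsets of an $N$-element set, being $0$ if $N<0$ or $k>N$. *)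

theory Defs
  imports Main
begin

text \<open>A sequence \<open>a\<^sub>1 \<dots> a\<^sub>n\<close> of nonnegative integers is a list, with \<open>a\<^sub>k = \<alpha> ! (k - 1)\<close>;
  positions \<open>k\<close> below are 1-based. The comparison \<open>a\<^sub>k\<^sub>+\<^sub>1 > a\<^sub>k - d\<close> is made in the integers,
  since subtraction on \<open>nat\<close> truncates.\<close>

definition is_d_ascent :: "nat \<Rightarrow> nat list \<Rightarrow> nat \<Rightarrow> bool" where
  "is_d_ascent d \<alpha> k \<longleftrightarrow> 1 \<le> k \<and> k < length \<alpha> \<and> int (\<alpha> ! k) > int (\<alpha> ! (k - 1)) - int d"

definition dasc :: "nat \<Rightarrow> nat list \<Rightarrow> nat" where
  "dasc d \<alpha> = card {k. is_d_ascent d \<alpha> k}"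

text \<open>The empty sequence counts as a \<open>d\<close>-ascent sequence.\<close>

definition d_ascent_sequence :: "nat \<Rightarrow> nat list \<Rightarrow> bool" where
  "d_ascent_sequence d \<alpha> \<longleftrightarrow>
     (\<alpha> \<noteq> [] \<longrightarrow> \<alpha> ! 0 = 0) \<and>
     (\<forall>k. 1 \<le> k \<and> k < length \<alpha> \<longrightarrow> \<alpha> ! k \<le> 1 + dasc d (take k \<alpha>))"

definition d_increasing :: "nat \<Rightarrow> nat list \<Rightarrow> bool" where
  "d_increasing d \<alpha> \<longleftrightarrow> (\<forall>k. 1 \<le> k \<and> k < length \<alpha> \<longrightarrow> is_d_ascent d \<alpha> k)"

definition di :: "nat \<Rightarrow> nat \<Rightarrow> nat" where
  "di d n = card {\<alpha>. length \<alpha> = n \<and> d_ascent_sequence d \<alpha> \<and> d_increasing d \<alpha>}"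

text \<open>The binomial coefficient with integer upper argument, taken to be 0 when that argument is
  negative (unlike \<open>gbinomial\<close>).\<close>

definition binom :: "int \<Rightarrow> nat \<Rightarrow> nat" where
  "binom N k = (if N < 0 then 0 else nat N choose k)"

end

theory Submission
  imports Defs
begin

text \<open>In a \<open>d\<close>-increasing sequence every prefix of length \<open>k \<ge> 1\<close> has \<open>k - 1\<close> \<open>d\<close>-ascents, so the
  \<open>d\<close>-increasing \<open>d\<close>-ascent sequences are the lists whose entry at the 0-based position \<open>i\<close> is at
  most \<open>i\<close> (\<open>restricted\<close>) and all of whose steps are \<open>d\<close>-ascents (\<open>inc\<close>).

  Up to its sign, the \<open>k\<close>-th term of the sum counts the pairs of a \<open>d\<close>-increasing sequence of length
  \<open>n - k\<close> and a list of length \<open>k\<close> whose first entry is at most \<open>n - k\<close> and none of whose steps is a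
  \<open>d\<close>-ascent (\<open>dec\<close>). Consecutive entries of the second list drop by at least \<open>d\<close>, so that it can be
  chosen in \<open>binom (n - k d + d) k\<close> ways (\<open>card_dec_lists\<close>). Concatenating such pairs gives exactly
  the restricted lists of length \<open>n\<close> that are \<open>d\<close>-increasing before the cut at \<open>n - k\<close> and have
  no \<open>d\<close>-ascent after it (\<open>card_cut_at_product\<close>).

  Only the step across the cut is unconstrained. If it is a \<open>d\<close>-ascent, the list is
  \<open>d\<close>-increasing up to the first entry after the cut and has no \<open>d\<close>-ascent from there on; otherwise the
  same holds with the last entry before the cut. Call that entry the peak, and let \<open>b k\<close> be the number
  of lists with the peak at the 0-based position \<open>n - k\<close>. Then the \<open>k\<close>-th term is \<open>b k + b (k + 1)\<close> up
  to its sign (\<open>card_cut_at\<close>); for \<open>k = n\<close> nothing precedes the cut, and \<open>b (n + 1) = 0\<close>. The alternating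
  sum telescopes to \<open>b 1\<close>, where the peak is the last entry and so the whole list is
  \<open>d\<close>-increasing.\<close>

abbreviation inc :: "nat \<Rightarrow> nat list \<Rightarrow> bool" where
  "inc d \<equiv> successively (\<lambda>x y. x < y + d)"

abbreviation dec :: "nat \<Rightarrow> nat list \<Rightarrow> bool" where
  "dec d \<equiv> successively (\<lambda>x y. y + d \<le> x)"

definition restricted :: "nat list \<Rightarrow> bool" where
  "restricted xs \<longleftrightarrow> (\<forall>i < length xs. xs ! i \<le> i)"

definition inc_lists :: "nat \<Rightarrow> nat \<Rightarrow> nat list set" where
  "inc_lists d n = {xs. length xs = n \<and> restricted xs \<and> inc d xs}"

definition dec_lists :: "nat \<Rightarrow> nat \<Rightarrow> nat \<Rightarrow> nat list set" where
  "dec_lists d k M = {ys. length ys = k \<and> dec d ys \<and> (ys \<noteq> [] \<longrightarrow> hd ys < M)}"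

definition cut_at :: "nat \<Rightarrow> nat \<Rightarrow> nat \<Rightarrow> nat list set" where
  "cut_at d n m = {xs. length xs = n \<and> restricted xs \<and> inc d (take m xs) \<and> dec d (drop m xs)}"

definition peak_at :: "nat \<Rightarrow> nat \<Rightarrow> nat \<Rightarrow> nat list set" where
  "peak_at d n m =
    {xs. length xs = n \<and> restricted xs \<and> inc d (take (Suc m) xs) \<and> dec d (drop m xs)}"

lemma finite_restricted: "finite {xs. length xs = n \<and> restricted xs}"
proof (rule finite_subset)
  show "{xs. length xs = n \<and> restricted xs} \<subseteq> {xs. set xs \<subseteq> {..n} \<and> length xs = n}"
    unfolding restricted_def set_conv_nth by fastforce
  show "finite {xs. set xs \<subseteq> {..n} \<and> length xs = n}"
    by (rule finite_lists_length_eq) simp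
qed

section \<open>Increasing sequences as restricted lists\<close>

lemma d_increasing_iff_inc: "d_increasing d xs \<longleftrightarrow> inc d xs"
proof
  assume "d_increasing d xs"
  then have "is_d_ascent d xs (Suc i)" if "Suc i < length xs" for i
    using that unfolding d_increasing_def by simp
  then show "inc d xs"
    unfolding successively_conv_nth is_d_ascent_def by fastforce
next
  assume inc: "inc d xs"
  show "d_increasing d xs"
    unfolding d_increasing_def
  proof (intro allI impI)
    fix k assume k: "1 \<le> k \<and> k < length xs"
    then have "xs ! (k - 1) < xs ! Suc (k - 1) + d"
      using inc unfolding successively_conv_nth by (metis Suc_diff_1 less_le_trans zero_less_one)
    with k show "is_d_ascent d xs k"
      unfolding is_d_ascent_def by simp
  qed
qed

lemma dasc_take_d_increasing:
  assumes "d_increasing d xs" "k \<le> length xs"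
  shows "dasc d (take k xs) = k - 1"
proof -
  have "{j. is_d_ascent d (take k xs) j} = {1..<k}"
    using assms unfolding d_increasing_def is_d_ascent_def by auto
  then show ?thesis
    unfolding dasc_def by simp
qed

lemma d_ascent_sequence_iff_restricted:
  assumes "d_increasing d xs"
  shows "d_ascent_sequence d xs \<longleftrightarrow> restricted xs"
proof -
  have "d_ascent_sequence d xs \<longleftrightarrow>
      (xs \<noteq> [] \<longrightarrow> xs ! 0 = 0) \<and> (\<forall>k. 1 \<le> k \<and> k < length xs \<longrightarrow> xs ! k \<le> k)"
    unfolding d_ascent_sequence_def using dasc_take_d_increasing[OF assms] by auto
  also have "\<dots> \<longleftrightarrow> restricted xs"
    unfolding restricted_def
    by (metis bot_nat_0.extremum_uniqueI le_numeral_extra(3) length_greater_0_conv less_one not_le)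
  finally show ?thesis .
qed

lemma di_eq_card_inc_lists: "di d n = card (inc_lists d n)"
  unfolding di_def inc_lists_def
  using d_ascent_sequence_iff_restricted d_increasing_iff_inc by (metis (lifting))

section \<open>Counting decreasing lists\<close>

text \<open>Here \<open>N\<close> is arbitrary: for \<open>N < 0\<close> all three coefficients vanish, in the case
  \<open>N = -1\<close> because the lower argument on the left is positive.\<close>

lemma binom_Pascal: "binom (N + 1) (Suc k) = binom N (Suc k) + binom N k"
proof (cases "N \<ge> 0")
  case True
  then have "nat (N + 1) = Suc (nat N)" by simp
  with True show ?thesis
    unfolding binom_def by simp
next
  case False
  then show ?thesis
    unfolding binom_def by auto
qed

lemma binom_eq_0: "N < int k \<Longrightarrow> binom N k = 0"
  unfolding binom_def by auto

lemma finite_dec_lists: "finite (dec_lists d k M)"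
proof (induction k arbitrary: M)
  case 0
  show ?case by (rule finite_subset[of _ "{[]}"]) (auto simp: dec_lists_def)
next
  case (Suc k)
  have "dec_lists d (Suc k) M \<subseteq> (\<Union>x<M. (#) x ` dec_lists d k (Suc x - d))"
    by (auto simp: dec_lists_def length_Suc_conv successively_Cons image_iff)
  then show ?case
    by (rule finite_subset) (use Suc in auto)
qed

text \<open>The lists with first entry \<open>M\<close> continue with an entry at most \<open>M - d\<close>. When \<open>M < d\<close>, no such
  entry exists, which the truncated difference \<open>Suc M - d = 0\<close> records.\<close>

lemma card_dec_lists_Suc:
  "card (dec_lists d (Suc k) (Suc M)) =
    card (dec_lists d (Suc k) M) + card (dec_lists d k (Suc M - d))"
proof -
  have "dec_lists d (Suc k) (Suc M) =
      dec_lists d (Suc k) M \<union> (#) M ` dec_lists d k (Suc M - d)"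
    by (auto simp: dec_lists_def length_Suc_conv successively_Cons image_iff)
  moreover have "dec_lists d (Suc k) M \<inter> (#) M ` dec_lists d k (Suc M - d) = {}"
    by (auto simp: dec_lists_def)
  moreover have "card ((#) M ` dec_lists d k (Suc M - d)) = card (dec_lists d k (Suc M - d))"
    by (rule card_image) simp
  ultimately show ?thesis
    by (simp add: card_Un_disjoint finite_dec_lists)
qed

text \<open>Adding \<open>(l - i) (1 - d)\<close> to the \<open>i\<close>-th entry of a list of length \<open>l = k + 1\<close>, for
  \<open>i = 1, \<dots>, l\<close>, makes it strictly decreasing, so these lists correspond to the \<open>l\<close>-subsets of
  \<open>{0..<M + k - k d}\<close>. The induction instead matches the recursion of \<open>card_dec_lists_Suc\<close> with
  Pascal's rule.\<close>

lemma card_dec_lists: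
  "card (dec_lists d (Suc k) M) = binom (int M + int k - int k * int d) (Suc k)"
proof (induction k arbitrary: M)
  case 0
  have "dec_lists d (Suc 0) M = (\<lambda>x. [x]) ` {..<M}"
    by (auto simp: dec_lists_def length_Suc_conv)
  moreover have "card ((\<lambda>x::nat. [x]) ` {..<M}) = M"
    by (subst card_image) (auto simp: inj_on_def)
  ultimately show ?case
    by (simp add: binom_def)
next
  case (Suc k)
  note IH_length = Suc.IH
  show ?case
  proof (induction M)
    case 0
    have "dec_lists d (Suc (Suc k)) 0 = {}"
      by (auto simp: dec_lists_def)
    moreover have "binom (int (Suc k) - int (Suc k) * int d) (Suc (Suc k)) = 0"
      by (rule binom_eq_0) (simp add: add_strict_increasing)
    ultimately show ?case by simp
  next
    case (Suc M)
    define N where "N = int M + int (Suc k) - int (Suc k) * int d"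
    have tail: "card (dec_lists d (Suc k) (Suc M - d)) = binom N (Suc k)"
    proof (cases "d \<le> Suc M")
      case True
      then have "int (Suc M - d) + int k - int k * int d = N"
        unfolding N_def by (simp add: algebra_simps)
      then show ?thesis
        by (simp add: IH_length)
    next
      case False
      have "N = int M - int d - int k * int d + int (Suc k)"
        unfolding N_def by (simp add: algebra_simps)
      moreover have "0 \<le> int k * int d" by simp
      ultimately have "N < int (Suc k)"
        using False by linarith
      moreover have "dec_lists d (Suc k) (Suc M - d) = {}"
        using False by (auto simp: dec_lists_def)
      ultimately show ?thesis
        by (simp add: binom_eq_0)
    qed
    have "card (dec_lists d (Suc (Suc k)) (Suc M)) = binom N (Suc (Suc k)) + binom N (Suc k)"
      unfolding card_dec_lists_Suc tail Suc.IH N_def ..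
    also have "\<dots> = binom (N + 1) (Suc (Suc k))"
      by (rule binom_Pascal[symmetric])
    also have "N + 1 = int (Suc M) + int (Suc k) - int (Suc k) * int d"
      unfolding N_def by simp
    finally show ?case .
  qed
qed

section \<open>Cuts and peaks\<close>

lemma dec_nth_le_hd:
  assumes "dec d ys" "i < length ys"
  shows "ys ! i \<le> hd ys"
  using assms(2)
proof (induction i)
  case 0
  then show ?case by (simp add: hd_conv_nth)
next
  case (Suc i)
  moreover from Suc.prems assms(1) have "ys ! Suc i + d \<le> ys ! i"
    unfolding successively_conv_nth by blast
  ultimately show ?case by simp
qed

text \<open>A decreasing list never exceeds its first entry, so in the part after the cut the restriction
  \<open>xs ! i \<le> i\<close> amounts to its instance at the cut.\<close>

lemma restricted_append_dec:
  assumes "dec d ys" "ys \<noteq> []"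
  shows "restricted (xs @ ys) \<longleftrightarrow> restricted xs \<and> hd ys \<le> length xs"
proof
  assume r: "restricted (xs @ ys)"
  have "xs ! i \<le> i" if "i < length xs" for i
    using r that unfolding restricted_def by (metis length_append nth_append trans_less_add1)
  moreover have "(xs @ ys) ! length xs \<le> length xs"
    using r assms(2) unfolding restricted_def by simp
  ultimately show "restricted xs \<and> hd ys \<le> length xs"
    using assms(2) unfolding restricted_def by (simp add: hd_conv_nth nth_append)
next
  assume r: "restricted xs \<and> hd ys \<le> length xs"
  show "restricted (xs @ ys)"
    unfolding restricted_def
  proof (intro allI impI)
    fix i assume i: "i < length (xs @ ys)"
    show "(xs @ ys) ! i \<le> i"
    proof (cases "i < length xs")
      case True
      with r show ?thesis by (simp add: restricted_def nth_append)
    next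
      case False
      with i have "ys ! (i - length xs) \<le> hd ys"
        by (intro dec_nth_le_hd[OF assms(1)]) auto
      with False r have "ys ! (i - length xs) \<le> i"
        by linarith
      with False show ?thesis
        by (simp add: nth_append)
    qed
  qed
qed

lemma card_cut_at_product:
  assumes "m < n"
  shows "card (cut_at d n m) = card (inc_lists d m) * card (dec_lists d (n - m) (Suc m))"
proof -
  let ?app = "\<lambda>(xs, ys). xs @ ys"
  have "cut_at d n m = ?app ` (inc_lists d m \<times> dec_lists d (n - m) (Suc m))"
  proof (intro equalityI subsetI)
    fix zs assume zs: "zs \<in> cut_at d n m"
    then have "drop m zs \<noteq> []" "length (take m zs) = m" "dec d (drop m zs)"
        "restricted (take m zs @ drop m zs)"
      using assms by (auto simp: cut_at_def)
    then have "restricted (take m zs)" "hd (drop m zs) \<le> m"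
      using restricted_append_dec[of d "drop m zs" "take m zs"] by metis+
    with zs have "take m zs \<in> inc_lists d m" "drop m zs \<in> dec_lists d (n - m) (Suc m)"
      using assms by (auto simp: cut_at_def inc_lists_def dec_lists_def)
    then show "zs \<in> ?app ` (inc_lists d m \<times> dec_lists d (n - m) (Suc m))"
      by (intro image_eqI[of _ _ "(take m zs, drop m zs)"]) auto
  next
    fix zs assume "zs \<in> ?app ` (inc_lists d m \<times> dec_lists d (n - m) (Suc m))"
    then obtain xs ys where zs: "zs = xs @ ys" "xs \<in> inc_lists d m"
        "ys \<in> dec_lists d (n - m) (Suc m)"
      by auto
    then have "ys \<noteq> []" "dec d ys"
      using assms by (auto simp: dec_lists_def)
    with zs show "zs \<in> cut_at d n m"
      using assms restricted_append_dec[of d ys xs]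
      by (auto simp: cut_at_def inc_lists_def dec_lists_def)
  qed
  moreover have "inj_on ?app (inc_lists d m \<times> dec_lists d (n - m) (Suc m))"
    by (auto simp: inj_on_def inc_lists_def)
  ultimately show ?thesis
    by (simp add: card_image card_cartesian_product)
qed

text \<open>The two cases of the step across the cut, from \<open>m\<close> to \<open>Suc m\<close>: if it is a \<open>d\<close>-ascent, it extends the
  increasing part, otherwise it extends the decreasing part.\<close>

lemma card_cut_at:
  assumes "Suc m < n"
  shows "card (cut_at d n (Suc m)) = card (peak_at d n (Suc m)) + card (peak_at d n m)"
proof -
  have inc: "inc d (take (Suc (Suc m)) xs) \<longleftrightarrow>
      inc d (take (Suc m) xs) \<and> xs ! m < xs ! Suc m + d" if "length xs = n" for xs
    using that assms
    by (auto simp: take_Suc_conv_app_nth successively_append_iff)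
  have dec: "dec d (drop m xs) \<longleftrightarrow>
      dec d (drop (Suc m) xs) \<and> \<not> xs ! m < xs ! Suc m + d" if "length xs = n" for xs
  proof -
    have "drop m xs = xs ! m # drop (Suc m) xs"
      using that assms by (simp add: Cons_nth_drop_Suc)
    then show ?thesis
      using that assms by (auto simp: successively_Cons hd_drop_conv_nth)
  qed
  have "cut_at d n (Suc m) = peak_at d n (Suc m) \<union> peak_at d n m"
    unfolding cut_at_def peak_at_def using inc dec by blast
  moreover have "peak_at d n (Suc m) \<inter> peak_at d n m = {}"
    unfolding peak_at_def using inc dec by blast
  moreover have "finite (peak_at d n i)" for i
    by (rule finite_subset[OF _ finite_restricted[of n]]) (auto simp: peak_at_def)
  ultimately show ?thesis
    by (simp add: card_Un_disjoint)
qed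

lemma cut_at_0: "cut_at d n 0 = peak_at d n 0"
proof -
  have "inc d (take (Suc 0) xs)" for xs
    by (cases xs) auto
  then show ?thesis
    unfolding cut_at_def peak_at_def by simp
qed

lemma peak_at_last: "peak_at d (Suc m) m = inc_lists d (Suc m)"
proof -
  have "dec d (drop m xs)" if "length xs = Suc m" for xs
  proof -
    from that have "drop m xs = [xs ! m]"
      using Cons_nth_drop_Suc[of m xs] by simp
    then show ?thesis by simp
  qed
  then show ?thesis
    unfolding peak_at_def inc_lists_def by auto
qed

lemma alternating_telescope:
  fixes b :: "nat \<Rightarrow> int"
  shows "(\<Sum>k = 1..n. (-1) ^ (k - 1) * (b k + b (Suc k))) = b 1 - (-1) ^ n * b (Suc n)"
  by (induction n) (auto simp: algebra_simps)

theorem theorem6p1: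
  fixes d n :: nat
  assumes "n \<ge> 1"
  shows "int (di d n) =
    (\<Sum>k = 1..n. (-1) ^ (k - 1) * int (binom (int n - int k * int d + int d) k) * int (di d (n - k)))"
proof -
  define b where "b k = (if k \<le> n then int (card (peak_at d n (n - k))) else 0)" for k
  have "int (binom (int n - int k * int d + int d) k) * int (di d (n - k)) = b k + b (Suc k)"
    if k: "k \<in> {1..n}" for k
  proof -
    from k obtain j where j: "k = Suc j"
      by (cases k) auto
    have "int (Suc (n - k)) + int j - int j * int d = int n - int k * int d + int d"
      using k j by (simp add: algebra_simps of_nat_diff)
    then have "card (dec_lists d k (Suc (n - k))) = binom (int n - int k * int d + int d) k"
      using card_dec_lists[of d j "Suc (n - k)"] j by simp
    then have "int (binom (int n - int k * int d + int d) k) * int (di d (n - k)) =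
        int (card (cut_at d n (n - k)))"
      using card_cut_at_product[of "n - k" n d] k by (simp add: di_eq_card_inc_lists)
    also have "\<dots> = b k + b (Suc k)"
    proof (cases "k = n")
      case True
      then show ?thesis by (simp add: b_def cut_at_0)
    next
      case False
      with k have "n - k = Suc (n - Suc k)" "n - k < n" by auto
      with False k show ?thesis
        using card_cut_at[of "n - Suc k" n d] by (simp add: b_def)
    qed
    finally show ?thesis .
  qed
  then have "(\<Sum>k = 1..n. (-1) ^ (k - 1) * int (binom (int n - int k * int d + int d) k) *
      int (di d (n - k))) = (\<Sum>k = 1..n. (-1) ^ (k - 1) * (b k + b (Suc k)))"
    by (intro sum.cong) (simp_all add: mult.assoc)
  also have "\<dots> = b 1"
    unfolding alternating_telescope by (simp add: b_def)
  also have "\<dots> = int (di d n)"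
    using assms peak_at_last[of d "n - 1"] by (simp add: b_def di_eq_card_inc_lists)
  finally show ?thesis by simp
qed

end
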